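(* Let $m \geq 2$, let $\mu \in \mathbb{R}\setminus\{0\}$, and let $D \subset \mathbb{R}^m$ be a bounded domain. If $u \in C^0(\overline D)$ is $\mu$-panharmonic in $D$, then \[ \sup_{x \in D} |u(x)| = \max_{x \in \partial D} |u(x)| . \]
   Context: A domain is a connected open set. A real-valued function $u \in C^2(D)$ is called $\mu$-panharmonic in $D$ if $\nabla^2 u - \mu^2 u = 0$ in $D$, where $\nabla^2$ is the Laplacian. *)

theory Defs
  imports "HOL-Analysis.Analysis"
begin

definition has_partial_at :: "'n \<Rightarrow> (real ^ 'n \<Rightarrow> real) \<Rightarrow> real ^ 'n \<Rightarrow> bool" where
  "has_partial_at i f x \<longleftrightarrow> (\<lambda>t::real. f (x + t *\<^sub>R axis i 1)) field_differentiable (at 0)"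

text \<open>The value is meaningful only at points where \<open>has_partial_at i f x\<close> holds.\<close>

definition partial_deriv :: "'n \<Rightarrow> (real ^ 'n \<Rightarrow> real) \<Rightarrow> real ^ 'n \<Rightarrow> real" where
  "partial_deriv i f x = deriv (\<lambda>t::real. f (x + t *\<^sub>R axis i 1)) 0"

text \<open>
  The class \<open>C\<^sup>2(D)\<close>, intended for open \<open>D\<close>: the function and all its partial derivatives
  of order one and two exist and are continuous in \<open>D\<close>. For open \<open>D\<close> this depends only on the
  values of the function in \<open>D\<close>.
\<close>

definition C2_on :: "(real ^ 'n) set \<Rightarrow> (real ^ 'n \<Rightarrow> real) \<Rightarrow> bool" where
  "C2_on D u \<longleftrightarrow>
     continuous_on D u \<and>
     (\<forall>i. (\<forall>x\<in>D. has_partial_at i u x) \<and> continuous_on D (partial_deriv i u)) \<and>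
     (\<forall>i j. (\<forall>x\<in>D. has_partial_at j (partial_deriv i u) x) \<and>
            continuous_on D (partial_deriv j (partial_deriv i u)))"

definition laplacian :: "(real ^ 'n \<Rightarrow> real) \<Rightarrow> real ^ 'n \<Rightarrow> real" where
  "laplacian u x = (\<Sum>i\<in>UNIV. partial_deriv i (partial_deriv i u) x)"

definition panharmonic_on :: "real \<Rightarrow> (real ^ 'n) set \<Rightarrow> (real ^ 'n \<Rightarrow> real) \<Rightarrow> bool" where
  "panharmonic_on \<mu> D u \<longleftrightarrow> C2_on D u \<and> (\<forall>x\<in>D. laplacian u x - \<mu>\<^sup>2 * u x = 0)"

end

theory Submission
  imports Defs
begin

text \<open>
  Since \<open>closure D\<close> is compact, \<open>\<bar>u\<bar>\<close> attains its maximum there, say at \<open>p\<close>. Suppose that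
  \<open>p\<close> lies in \<open>D\<close>. As \<open>\<bar>u y\<bar> \<le> \<bar>u p\<bar>\<close> for all \<open>y\<close>, the function \<open>u p * u y\<close> of \<open>y\<close> is maximal
  at \<open>y = p\<close>; hence all its second partial derivatives are nonpositive there, and summing them
  gives \<open>u p * laplacian u p \<le> 0\<close>. But the equation turns the left-hand side into
  \<open>(\<mu> * u p)\<^sup>2\<close>, so \<open>u p = 0\<close> and \<open>u\<close> vanishes identically on \<open>closure D\<close>. Multiplying by the
  constant \<open>u p\<close> treats positive maxima and negative minima of \<open>u\<close> at once.

  So the maximum over \<open>closure D\<close> is in every case attained on the frontier, which is nonempty
  because \<open>D\<close> is a nonempty bounded set, and by continuity it equals the supremum over \<open>D\<close>.
\<close>

text \<open>
  If the second derivative at \<open>0\<close> were positive, the first derivative, which vanishes at the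
  maximum, would be positive just to the right of \<open>0\<close>, and \<open>g\<close> would increase there.
\<close>

lemma second_derivative_nonpos_at_local_max:
  fixes g g' :: "real \<Rightarrow> real"
  assumes "d > 0"
    and deriv: "\<And>t. \<bar>t\<bar> < d \<Longrightarrow> (g has_real_derivative g' t) (at t)"
    and deriv2: "(g' has_real_derivative l) (at 0)"
    and max: "\<And>t. \<bar>t\<bar> < d \<Longrightarrow> g t \<le> g 0"
  shows "l \<le> 0"
proof (rule ccontr)
  assume "\<not> l \<le> 0"
  have "g' 0 = 0"
    using DERIV_local_max[OF deriv[of 0] \<open>d > 0\<close>] max \<open>d > 0\<close> by auto
  with \<open>\<not> l \<le> 0\<close> obtain e where e: "e > 0" "\<And>h. 0 < h \<Longrightarrow> h < e \<Longrightarrow> 0 < g' h"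
    using DERIV_pos_inc_right[OF deriv2] by auto
  define b where "b = min d e / 2"
  have b: "0 < b" "b < d" "b < e"
    using \<open>d > 0\<close> e(1) by (auto simp: b_def)
  have "g 0 < g b"
  proof (rule DERIV_pos_imp_increasing_open[OF b(1)])
    fix t assume "0 < t" "t < b"
    then show "\<exists>y. (g has_real_derivative y) (at t) \<and> 0 < y"
      using deriv[of t] e(2)[of t] b by auto
  next
    have "isCont g t" if "t \<in> {0..b}" for t
      using DERIV_isCont[OF deriv[of t]] that b by auto
    then show "continuous_on {0..b} g"
      by (simp add: continuous_at_imp_continuous_on)
  qed
  with max[of b] b show False by simp
qed

lemma has_real_derivative_partial_deriv:
  assumes "has_partial_at i f (x + t *\<^sub>R axis i 1)"
  shows "((\<lambda>s. f (x + s *\<^sub>R axis i 1)) has_real_derivative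
           partial_deriv i f (x + t *\<^sub>R axis i 1)) (at t)"
proof -
  have "((\<lambda>s. f (x + t *\<^sub>R axis i 1 + s *\<^sub>R axis i 1)) has_real_derivative
           partial_deriv i f (x + t *\<^sub>R axis i 1)) (at 0)"
    using assms unfolding has_partial_at_def partial_deriv_def
    by (simp add: DERIV_deriv_iff_field_differentiable)
  then show ?thesis
    using DERIV_at_within_shift[of "\<lambda>s. f (x + s *\<^sub>R axis i 1)" _ t 0 UNIV]
    by (simp add: algebra_simps)
qed

lemma second_partial_deriv_nonpos_at_max:
  fixes u :: "real ^ 'n \<Rightarrow> real"
  assumes "open D" "C2_on D u" "x \<in> D"
    and max: "\<And>y. y \<in> D \<Longrightarrow> c * u y \<le> c * u x"
  shows "c * partial_deriv i (partial_deriv i u) x \<le> 0"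
proof -
  obtain d where d: "d > 0" "ball x d \<subseteq> D"
    using \<open>open D\<close> \<open>x \<in> D\<close> by (meson open_contains_ball)
  have line: "x + t *\<^sub>R axis i 1 \<in> D" if "\<bar>t\<bar> < d" for t
    using d(2) that by (auto simp: dist_norm)
  show ?thesis
  proof (rule second_derivative_nonpos_at_local_max[OF d(1)])
    fix t :: real assume t: "\<bar>t\<bar> < d"
    show "((\<lambda>t. c * u (x + t *\<^sub>R axis i 1)) has_real_derivative
            c * partial_deriv i u (x + t *\<^sub>R axis i 1)) (at t)"
      using \<open>C2_on D u\<close> line[OF t]
      by (intro DERIV_cmult has_real_derivative_partial_deriv) (simp add: C2_on_def)
    show "c * u (x + t *\<^sub>R axis i 1) \<le> c * u (x + 0 *\<^sub>R axis i 1)"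
      using max[OF line[OF t]] by simp
  next
    have "has_partial_at i (partial_deriv i u) (x + 0 *\<^sub>R axis i 1)"
      using \<open>C2_on D u\<close> \<open>x \<in> D\<close> by (simp add: C2_on_def)
    from DERIV_cmult[OF has_real_derivative_partial_deriv[OF this]]
    show "((\<lambda>t. c * partial_deriv i u (x + t *\<^sub>R axis i 1)) has_real_derivative
            c * partial_deriv i (partial_deriv i u) x) (at 0)"
      by simp
  qed
qed

text \<open>
  This is where the sign of the zero-order term enters: for \<open>\<Delta>u + \<mu>\<^sup>2u = 0\<close>, functions such as
  \<open>sin (\<mu> * x\<^sub>1)\<close> do have nonzero interior maxima of \<open>\<bar>u\<bar>\<close>.
\<close>

lemma panharmonic_eq_0_at_interior_max:
  fixes u :: "real ^ 'n \<Rightarrow> real"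
  assumes "open D" "\<mu> \<noteq> 0" "panharmonic_on \<mu> D u" "p \<in> D"
    and max: "\<And>y. y \<in> D \<Longrightarrow> \<bar>u y\<bar> \<le> \<bar>u p\<bar>"
  shows "u p = 0"
proof -
  have "u p * u y \<le> u p * u p" if "y \<in> D" for y
  proof -
    have "u p * u y \<le> \<bar>u p\<bar> * \<bar>u y\<bar>"
      by (metis abs_ge_self abs_mult)
    also have "\<dots> \<le> \<bar>u p\<bar> * \<bar>u p\<bar>"
      using max[OF that] by (rule mult_left_mono) simp
    finally show ?thesis by simp
  qed
  then have "u p * partial_deriv i (partial_deriv i u) p \<le> 0" for i
    using assms second_partial_deriv_nonpos_at_max[of D u p "u p" i]
    by (auto simp: panharmonic_on_def)
  then have "u p * laplacian u p \<le> 0"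
    unfolding laplacian_def sum_distrib_left by (intro sum_nonpos)
  moreover have "laplacian u p = \<mu>\<^sup>2 * u p"
    using assms by (auto simp: panharmonic_on_def)
  ultimately have "(\<mu> * u p)\<^sup>2 \<le> 0"
    by (simp add: power2_eq_square algebra_simps)
  with \<open>\<mu> \<noteq> 0\<close> show ?thesis by simp
qed

theorem theorem2p2:
  fixes \<mu> :: real and D :: "(real ^ 'n) set" and u :: "real ^ 'n \<Rightarrow> real"
  assumes "CARD('n) \<ge> 2"
    and "\<mu> \<noteq> 0"
    and "open D" and "connected D" and "D \<noteq> {}" and "bounded D"
    and "continuous_on (closure D) u"
    and "panharmonic_on \<mu> D u"
  shows "bdd_above ((\<lambda>x. \<bar>u x\<bar>) ` D) \<and>
    (\<exists>x\<^sub>0\<in>frontier D. (\<forall>x\<in>frontier D. \<bar>u x\<bar> \<le> \<bar>u x\<^sub>0\<bar>) \<and>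
       (SUP x\<in>D. \<bar>u x\<bar>) = \<bar>u x\<^sub>0\<bar>)"
proof -
  have cont: "continuous_on (closure D) (\<lambda>x. \<bar>u x\<bar>)"
    using assms(7) by (rule continuous_on_rabs)
  obtain p where p: "p \<in> closure D" "\<And>y. y \<in> closure D \<Longrightarrow> \<bar>u y\<bar> \<le> \<bar>u p\<bar>"
    using continuous_attains_sup[OF _ _ cont] \<open>bounded D\<close> \<open>D \<noteq> {}\<close> by auto
  have "\<exists>q\<in>frontier D. \<bar>u q\<bar> = \<bar>u p\<bar>"
  proof (cases "p \<in> D")
    case True
    then have "u p = 0"
      using panharmonic_eq_0_at_interior_max[of D \<mu> u p] assms p(2) closure_subset by blast
    moreover obtain q where "q \<in> frontier D"
      using \<open>D \<noteq> {}\<close> \<open>bounded D\<close> frontier_not_empty not_bounded_UNIV by blast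
    moreover from this have "q \<in> closure D"
      by (simp add: frontier_def)
    ultimately show ?thesis
      using p(2)[of q] by force
  next
    case False
    then show ?thesis
      using p(1) \<open>open D\<close> by (auto simp: frontier_def interior_open)
  qed
  then obtain q where q: "q \<in> frontier D" "\<And>y. y \<in> closure D \<Longrightarrow> \<bar>u y\<bar> \<le> \<bar>u q\<bar>"
    using p(2) by force
  have q_closure: "q \<in> closure D"
    using q(1) by (simp add: frontier_def)
  have bdd: "bdd_above ((\<lambda>x. \<bar>u x\<bar>) ` D)"
    using q(2) closure_subset by (intro bdd_aboveI2[of _ _ "\<bar>u q\<bar>"]) blast
  have "(SUP x\<in>D. \<bar>u x\<bar>) = \<bar>u q\<bar>"
  proof (rule antisym)
    show "(SUP x\<in>D. \<bar>u x\<bar>) \<le> \<bar>u q\<bar>"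
      using \<open>D \<noteq> {}\<close> q(2) closure_subset by (intro cSUP_least) auto
    show "\<bar>u q\<bar> \<le> (SUP x\<in>D. \<bar>u x\<bar>)"
      using continuous_le_on_closure[OF cont q_closure] cSUP_upper[OF _ bdd] by blast
  qed
  moreover have "\<forall>x\<in>frontier D. \<bar>u x\<bar> \<le> \<bar>u q\<bar>"
    using q(2) by (simp add: frontier_def)
  ultimately show ?thesis
    using bdd q(1) by blast
qed

end
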